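(* Let $\mathcal{E}$ be any one of the three families of deformed equations ${\rm H1}^\sigma_\epsilon$, ${\rm H2}^\sigma_\epsilon$, ${\rm H3}^\sigma_\epsilon$, $\sigma\in\{1,-1\}$, and consider the equation $\mathcal{E}(u_{n,m},u_{n+1,m},u_{n,m+1},u_{n+1,m+1};n,m;\alpha,\beta;\sigma)=0$ on an elementary quadrilateral. This equation possesses two different three-leg forms, a white one in the variables $x_1,\dots,x_4$ and a black one in the variables $y_1,\dots,y_4$: for generic values it is equivalent to the white relation and also equivalent to the black relation, where these are as follows. (1) ${\rm H1}^\sigma_\epsilon$. White: $F(x_1,x_2,\alpha)-F(x_1,x_3,\beta)=W(x_1,x_4)$ with $$F(x_1,x_2,\alpha)=x_1+x_2,\qquad W(x_1,x_4)=(\alpha-\beta)\frac{1-\epsilon x_1x_4}{x_1-x_4}.$$ Black: $F(y_1,y_2,\alpha)/F(y_1,y_3,\beta)=W(y_1,y_4)$ with $$F(y_1,y_2,\alpha)=\frac{1-\sqrt\epsilon\,y_1}{1+\sqrt\epsilon\,y_1}\cdot\frac{1-\sqrt\epsilon\,y_2}{1+\sqrt\epsilon\,y_2},\qquad W(y_1,y_4)=\frac{y_4-y_1+\sqrt\epsilon(\alpha-\beta)}{y_4-y_1-\sqrt\epsilon(\alpha-\beta)}.$$ (2) ${\rm H2}^\sigma_\epsilon$. White: $F(x_1,x_2,\alpha)/F(x_1,x_3,\beta)=W(x_1,x_4)$ with $$F(x_1,x_2,\alpha)=x_1+x_2+\alpha-2\epsilon(x_1+\alpha)^2,\qquad W(x_1,x_4)=\frac{x_1-x_4+\alpha-\beta}{x_1-x_4-\alpha+\beta}.$$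 Black: $F(y_1,y_2,\alpha)/F(y_1,y_3,\beta)=W(y_1,y_4)$ with $$F(y_1,y_2,\alpha)=\frac{1-4\epsilon(y_2+\alpha)-\sqrt{1+8\epsilon y_1}}{1-4\epsilon(y_2+\alpha)+\sqrt{1+8\epsilon y_1}},\qquad W(y_1,y_4)=\frac{y_1-y_4+(\alpha-\beta)\big(2\epsilon(\alpha-\beta)+\sqrt{1+8\epsilon y_1}\big)}{y_1-y_4+(\alpha-\beta)\big(2\epsilon(\alpha-\beta)-\sqrt{1+8\epsilon y_1}\big)}.$$ (3) ${\rm H3}^\sigma_\epsilon$. White: $F(x_1,x_2,\alpha)/F(x_1,x_3,\beta)=W(x_1,x_4)$ with $$F(x_1,x_2,\alpha)=\alpha x_1x_2+\delta\alpha^2-\epsilon x_1^2,\qquad W(x_1,x_4)=\frac{\alpha}{\beta}\cdot\frac{\alpha x_4-\beta x_1}{\beta x_4-\alpha x_1}.$$ Black: $F(y_1,y_2,\alpha)/F(y_1,y_3,\beta)=W(y_1,y_4)$ with $$F(y_1,y_2,\alpha)=\frac{\alpha\big(y_1+\sqrt{y_1^2+4\epsilon\delta}\big)-2\epsilon y_2}{\alpha\big(y_1-\sqrt{y_1^2+4\epsilon\delta}\big)-2\epsilon y_2},$$ $$W(y_1,y_4)=\frac{(\alpha^2+\beta^2)y_1-2\alpha\beta y_4+(\alpha^2-\beta^2)\sqrt{y_1^2+4\epsilon\delta}}{(\alpha^2+\beta^2)y_1-2\alpha\beta y_4-(\alpha^2-\beta^2)\sqrt{y_1^2+4\epsilon\delta}}.$$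 In all cases the same holds with the variables $x_i$, $y_i$ obtained after interchanging mutually $u_{n,m}$ with $u_{n+1,m+1}$ and $u_{n+1,m}$ with $u_{n,m+1}$.
   Context: Let $\epsilon,\delta,\alpha,\beta$ be complex constants and $\sigma\in\{1,-1\}$. Put $$\mathcal{X}_{n,m}=\frac{1+\sigma(-1)^{n+m}}{2},\qquad \mathcal{Y}_{n,m}=\frac{1-\sigma(-1)^{n+m}}{2}.$$ Writing $w_1=u_{n,m}$, $w_2=u_{n+1,m}$, $w_3=u_{n,m+1}$, $w_4=u_{n+1,m+1}$, the polynomial $\mathcal{E}(w_1,w_2,w_3,w_4;n,m;\alpha,\beta;\sigma)$ is one of: - ${\rm H1}^\sigma_\epsilon$: $(w_1-w_4)(w_2-w_3)-(\alpha-\beta)+\epsilon(\alpha-\beta)\{\mathcal{X}_{n,m}w_2w_3+\mathcal{Y}_{n,m}w_1w_4\}$; - ${\rm H2}^\sigma_\epsilon$: $(w_1-w_4)(w_2-w_3)+(\beta-\alpha)(w_1+w_2+w_3+w_4)-\alpha^2+\beta^2-\epsilon(\beta-\alpha)^3-\epsilon(\beta-\alpha)\{2\mathcal{Y}_{n,m}w_1+2\mathcal{X}_{n,m}w_2+\alpha+\beta\}\{2\mathcal{Y}_{n,m}w_4+2\mathcal{X}_{n,m}w_3+\alpha+\beta\}$; - ${\rm H3}^\sigma_\epsilon$: $\alpha(w_1w_2+w_3w_4)-\beta(w_1w_3+w_2w_4)+(\alpha^2-\beta^2)\delta-\frac{\epsilon(\alpha^2-\beta^2)}{\alpha\beta}\{\mathcal{X}_{n,m}w_2w_3+\mathcal{Y}_{n,m}w_1w_4\}$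 ($\alpha\beta\neq0$). White variables: $$x_1=\mathcal{Y}_{n,m}u_{n,m}+\mathcal{X}_{n,m}u_{n+1,m},\quad x_2=\mathcal{Y}_{n,m}u_{n+1,m}+\mathcal{X}_{n,m}u_{n,m},$$ $$x_3=\mathcal{Y}_{n,m}u_{n,m+1}+\mathcal{X}_{n,m}u_{n+1,m+1},\quad x_4=\mathcal{Y}_{n,m}u_{n+1,m+1}+\mathcal{X}_{n,m}u_{n,m+1}.$$ Black variables: $y_i$ is obtained from $x_i$ by interchanging $\mathcal{X}_{n,m}$ and $\mathcal{Y}_{n,m}$. In each formula $F(x_1,x_3,\beta)$ (resp. $F(y_1,y_3,\beta)$) is obtained from the displayed $F$ by replacing the second argument and $\alpha$ by $x_3$ (resp. $y_3$) and $\beta$; a fixed choice of each square root is used throughout a given relation. "Generic values" means: all denominators occurring in the relation considered, including $F(\cdot,\cdot,\beta)$ in the quotients, are nonzero; in the black forms $\epsilon\neq0$; moreover $1+8\epsilon y_1\neq0$ in the black form of ${\rm H2}^\sigma_\epsilon$, $x_1\neq0$ in the white form of ${\rm H3}^\sigma_\epsilon$, and $y_1^2+4\epsilon\delta\neq0$ in the black form of ${\rm H3}^\sigma_\epsilon$. *)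

theory Defs
  imports Complex_Main
begin

definition chiX :: "complex \<Rightarrow> int \<Rightarrow> int \<Rightarrow> complex" where
  "chiX \<sigma> n m = (1 + \<sigma> * (-1) powi (n + m)) / 2"

definition chiY :: "complex \<Rightarrow> int \<Rightarrow> int \<Rightarrow> complex" where
  "chiY \<sigma> n m = (1 - \<sigma> * (-1) powi (n + m)) / 2"

type_synonym quadruple = "complex \<times> complex \<times> complex \<times> complex"

definition quad_values :: "(int \<Rightarrow> int \<Rightarrow> complex) \<Rightarrow> int \<Rightarrow> int \<Rightarrow> quadruple" where
  "quad_values u n m = (u n m, u (n + 1) m, u n (m + 1), u (n + 1) (m + 1))"

fun interchange :: "quadruple \<Rightarrow> quadruple" where
  "interchange (w1, w2, w3, w4) = (w4, w3, w2, w1)"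

datatype family = H1 | H2 | H3

text \<open>Only H3 depends on \<open>\<delta>\<close>.\<close>

fun quad_poly :: "family \<Rightarrow> complex \<Rightarrow> complex \<Rightarrow> quadruple \<Rightarrow> int \<Rightarrow> int
    \<Rightarrow> complex \<Rightarrow> complex \<Rightarrow> complex \<Rightarrow> complex" where
  "quad_poly H1 \<epsilon> \<delta> (w1, w2, w3, w4) n m \<alpha> \<beta> \<sigma> =
     (w1 - w4) * (w2 - w3) - (\<alpha> - \<beta>)
     + \<epsilon> * (\<alpha> - \<beta>) * (chiX \<sigma> n m * w2 * w3 + chiY \<sigma> n m * w1 * w4)"
| "quad_poly H2 \<epsilon> \<delta> (w1, w2, w3, w4) n m \<alpha> \<beta> \<sigma> =
     (w1 - w4) * (w2 - w3) + (\<beta> - \<alpha>) * (w1 + w2 + w3 + w4) - \<alpha>\<^sup>2 + \<beta>\<^sup>2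
     - \<epsilon> * (\<beta> - \<alpha>) ^ 3
     - \<epsilon> * (\<beta> - \<alpha>) * (2 * chiY \<sigma> n m * w1 + 2 * chiX \<sigma> n m * w2 + \<alpha> + \<beta>)
                     * (2 * chiY \<sigma> n m * w4 + 2 * chiX \<sigma> n m * w3 + \<alpha> + \<beta>)"
| "quad_poly H3 \<epsilon> \<delta> (w1, w2, w3, w4) n m \<alpha> \<beta> \<sigma> =
     \<alpha> * (w1 * w2 + w3 * w4) - \<beta> * (w1 * w3 + w2 * w4) + (\<alpha>\<^sup>2 - \<beta>\<^sup>2) * \<delta>
     - \<epsilon> * (\<alpha>\<^sup>2 - \<beta>\<^sup>2) / (\<alpha> * \<beta>) * (chiX \<sigma> n m * w2 * w3 + chiY \<sigma> n m * w1 * w4)"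

fun white_vars :: "complex \<Rightarrow> int \<Rightarrow> int \<Rightarrow> quadruple \<Rightarrow> quadruple" where
  "white_vars \<sigma> n m (w1, w2, w3, w4) =
     (chiY \<sigma> n m * w1 + chiX \<sigma> n m * w2,
      chiY \<sigma> n m * w2 + chiX \<sigma> n m * w1,
      chiY \<sigma> n m * w3 + chiX \<sigma> n m * w4,
      chiY \<sigma> n m * w4 + chiX \<sigma> n m * w3)"

fun black_vars :: "complex \<Rightarrow> int \<Rightarrow> int \<Rightarrow> quadruple \<Rightarrow> quadruple" where
  "black_vars \<sigma> n m (w1, w2, w3, w4) =
     (chiX \<sigma> n m * w1 + chiY \<sigma> n m * w2,
      chiX \<sigma> n m * w2 + chiY \<sigma> n m * w1,
      chiX \<sigma> n m * w3 + chiY \<sigma> n m * w4,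
      chiX \<sigma> n m * w4 + chiY \<sigma> n m * w3)"

text \<open>A three-leg form is given by a leg \<open>F z1 z2 \<alpha>\<close> and a long leg \<open>W \<alpha> \<beta> z1 z4\<close>.\<close>

datatype three_leg_form =
    Additive "complex \<Rightarrow> complex \<Rightarrow> complex \<Rightarrow> complex"
             "complex \<Rightarrow> complex \<Rightarrow> complex \<Rightarrow> complex \<Rightarrow> complex"
  | Multiplicative "complex \<Rightarrow> complex \<Rightarrow> complex \<Rightarrow> complex"
                   "complex \<Rightarrow> complex \<Rightarrow> complex \<Rightarrow> complex \<Rightarrow> complex"

fun three_leg_relation ::
    "three_leg_form \<Rightarrow> complex \<Rightarrow> complex \<Rightarrow> quadruple \<Rightarrow> bool" where
  "three_leg_relation (Additive F W) \<alpha> \<beta> (z1, z2, z3, z4) \<longleftrightarrow>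
     F z1 z2 \<alpha> - F z1 z3 \<beta> = W \<alpha> \<beta> z1 z4"
| "three_leg_relation (Multiplicative F W) \<alpha> \<beta> (z1, z2, z3, z4) \<longleftrightarrow>
     F z1 z2 \<alpha> / F z1 z3 \<beta> = W \<alpha> \<beta> z1 z4"

fun divisor_leg_nonzero ::
    "three_leg_form \<Rightarrow> complex \<Rightarrow> quadruple \<Rightarrow> bool" where
  "divisor_leg_nonzero (Additive F W) \<beta> (z1, z2, z3, z4) \<longleftrightarrow> True"
| "divisor_leg_nonzero (Multiplicative F W) \<beta> (z1, z2, z3, z4) \<longleftrightarrow> F z1 z3 \<beta> \<noteq> 0"

fun white_form :: "family \<Rightarrow> complex \<Rightarrow> complex \<Rightarrow> three_leg_form" where
  "white_form H1 \<epsilon> \<delta> = Additive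
     (\<lambda>x1 x2 \<alpha>. x1 + x2)
     (\<lambda>\<alpha> \<beta> x1 x4. (\<alpha> - \<beta>) * ((1 - \<epsilon> * x1 * x4) / (x1 - x4)))"
| "white_form H2 \<epsilon> \<delta> = Multiplicative
     (\<lambda>x1 x2 \<alpha>. x1 + x2 + \<alpha> - 2 * \<epsilon> * (x1 + \<alpha>)\<^sup>2)
     (\<lambda>\<alpha> \<beta> x1 x4. (x1 - x4 + \<alpha> - \<beta>) / (x1 - x4 - \<alpha> + \<beta>))"
| "white_form H3 \<epsilon> \<delta> = Multiplicative
     (\<lambda>x1 x2 \<alpha>. \<alpha> * x1 * x2 + \<delta> * \<alpha>\<^sup>2 - \<epsilon> * x1\<^sup>2)
     (\<lambda>\<alpha> \<beta> x1 x4. (\<alpha> / \<beta>) * ((\<alpha> * x4 - \<beta> * x1) / (\<beta> * x4 - \<alpha> * x1)))"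

text \<open>\<open>sq\<close> is a choice of square roots, i.e. \<open>(sq z)\<^sup>2 = z\<close> for all \<open>z\<close>; no branch is preferred.\<close>

fun black_form :: "(complex \<Rightarrow> complex) \<Rightarrow> family \<Rightarrow> complex \<Rightarrow> complex \<Rightarrow> three_leg_form" where
  "black_form sq H1 \<epsilon> \<delta> = Multiplicative
     (\<lambda>y1 y2 \<alpha>. ((1 - sq \<epsilon> * y1) / (1 + sq \<epsilon> * y1)) * ((1 - sq \<epsilon> * y2) / (1 + sq \<epsilon> * y2)))
     (\<lambda>\<alpha> \<beta> y1 y4. (y4 - y1 + sq \<epsilon> * (\<alpha> - \<beta>)) / (y4 - y1 - sq \<epsilon> * (\<alpha> - \<beta>)))"
| "black_form sq H2 \<epsilon> \<delta> = Multiplicative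
     (\<lambda>y1 y2 \<alpha>. (1 - 4 * \<epsilon> * (y2 + \<alpha>) - sq (1 + 8 * \<epsilon> * y1))
              / (1 - 4 * \<epsilon> * (y2 + \<alpha>) + sq (1 + 8 * \<epsilon> * y1)))
     (\<lambda>\<alpha> \<beta> y1 y4. (y1 - y4 + (\<alpha> - \<beta>) * (2 * \<epsilon> * (\<alpha> - \<beta>) + sq (1 + 8 * \<epsilon> * y1)))
                / (y1 - y4 + (\<alpha> - \<beta>) * (2 * \<epsilon> * (\<alpha> - \<beta>) - sq (1 + 8 * \<epsilon> * y1))))"
| "black_form sq H3 \<epsilon> \<delta> = Multiplicative
     (\<lambda>y1 y2 \<alpha>. (\<alpha> * (y1 + sq (y1\<^sup>2 + 4 * \<epsilon> * \<delta>)) - 2 * \<epsilon> * y2)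
              / (\<alpha> * (y1 - sq (y1\<^sup>2 + 4 * \<epsilon> * \<delta>)) - 2 * \<epsilon> * y2))
     (\<lambda>\<alpha> \<beta> y1 y4.
        ((\<alpha>\<^sup>2 + \<beta>\<^sup>2) * y1 - 2 * \<alpha> * \<beta> * y4 + (\<alpha>\<^sup>2 - \<beta>\<^sup>2) * sq (y1\<^sup>2 + 4 * \<epsilon> * \<delta>))
      / ((\<alpha>\<^sup>2 + \<beta>\<^sup>2) * y1 - 2 * \<alpha> * \<beta> * y4 - (\<alpha>\<^sup>2 - \<beta>\<^sup>2) * sq (y1\<^sup>2 + 4 * \<epsilon> * \<delta>)))"

text \<open>Genericity: the denominators inside \<open>F z1 z2 \<alpha>\<close>, \<open>F z1 z3 \<beta>\<close> and \<open>W\<close>, together with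
  the divisor \<open>F z1 z3 \<beta>\<close> and the family-specific conditions, are nonzero.\<close>

fun white_generic :: "family \<Rightarrow> complex \<Rightarrow> complex \<Rightarrow> complex \<Rightarrow> complex \<Rightarrow> quadruple \<Rightarrow> bool" where
  "white_generic H1 \<epsilon> \<delta> \<alpha> \<beta> (x1, x2, x3, x4) \<longleftrightarrow> x1 - x4 \<noteq> 0"
| "white_generic H2 \<epsilon> \<delta> \<alpha> \<beta> (x1, x2, x3, x4) \<longleftrightarrow>
     divisor_leg_nonzero (white_form H2 \<epsilon> \<delta>) \<beta> (x1, x2, x3, x4) \<and>
     x1 - x4 - \<alpha> + \<beta> \<noteq> 0"
| "white_generic H3 \<epsilon> \<delta> \<alpha> \<beta> (x1, x2, x3, x4) \<longleftrightarrow>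
     divisor_leg_nonzero (white_form H3 \<epsilon> \<delta>) \<beta> (x1, x2, x3, x4) \<and>
     \<beta> \<noteq> 0 \<and> \<beta> * x4 - \<alpha> * x1 \<noteq> 0 \<and>
     x1 \<noteq> 0"

fun black_generic :: "(complex \<Rightarrow> complex) \<Rightarrow> family \<Rightarrow> complex \<Rightarrow> complex \<Rightarrow> complex \<Rightarrow> complex
    \<Rightarrow> quadruple \<Rightarrow> bool" where
  "black_generic sq H1 \<epsilon> \<delta> \<alpha> \<beta> (y1, y2, y3, y4) \<longleftrightarrow>
     divisor_leg_nonzero (black_form sq H1 \<epsilon> \<delta>) \<beta> (y1, y2, y3, y4) \<and>
     1 + sq \<epsilon> * y1 \<noteq> 0 \<and> 1 + sq \<epsilon> * y2 \<noteq> 0 \<and> 1 + sq \<epsilon> * y3 \<noteq> 0 \<and>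
     y4 - y1 - sq \<epsilon> * (\<alpha> - \<beta>) \<noteq> 0 \<and>
     \<epsilon> \<noteq> 0"
| "black_generic sq H2 \<epsilon> \<delta> \<alpha> \<beta> (y1, y2, y3, y4) \<longleftrightarrow>
     divisor_leg_nonzero (black_form sq H2 \<epsilon> \<delta>) \<beta> (y1, y2, y3, y4) \<and>
     1 - 4 * \<epsilon> * (y2 + \<alpha>) + sq (1 + 8 * \<epsilon> * y1) \<noteq> 0 \<and>
     1 - 4 * \<epsilon> * (y3 + \<beta>) + sq (1 + 8 * \<epsilon> * y1) \<noteq> 0 \<and>
     y1 - y4 + (\<alpha> - \<beta>) * (2 * \<epsilon> * (\<alpha> - \<beta>) - sq (1 + 8 * \<epsilon> * y1)) \<noteq> 0 \<and>
     \<epsilon> \<noteq> 0 \<and> 1 + 8 * \<epsilon> * y1 \<noteq> 0"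
| "black_generic sq H3 \<epsilon> \<delta> \<alpha> \<beta> (y1, y2, y3, y4) \<longleftrightarrow>
     divisor_leg_nonzero (black_form sq H3 \<epsilon> \<delta>) \<beta> (y1, y2, y3, y4) \<and>
     \<alpha> * (y1 - sq (y1\<^sup>2 + 4 * \<epsilon> * \<delta>)) - 2 * \<epsilon> * y2 \<noteq> 0 \<and>
     \<beta> * (y1 - sq (y1\<^sup>2 + 4 * \<epsilon> * \<delta>)) - 2 * \<epsilon> * y3 \<noteq> 0 \<and>
     (\<alpha>\<^sup>2 + \<beta>\<^sup>2) * y1 - 2 * \<alpha> * \<beta> * y4 - (\<alpha>\<^sup>2 - \<beta>\<^sup>2) * sq (y1\<^sup>2 + 4 * \<epsilon> * \<delta>) \<noteq> 0 \<and>
     \<epsilon> \<noteq> 0 \<and> y1\<^sup>2 + 4 * \<epsilon> * \<delta> \<noteq> 0"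

end

(* On an elementary quadrilateral exactly one of X, Y is 1 and the other 0, so up to relabelling the
   vertices the equation is a single fixed polynomial in the white variables, and another one in the
   black variables. Clearing denominators in a three-leg relation gives this polynomial times an
   explicit factor, which genericity makes nonzero. The relabelling by interchange is a symmetry of
   the polynomial. *)

theory Submission
  imports Defs
begin

lemma chi_cases:
  assumes "\<sigma> \<in> {1, -1}"
  obtains "chiX \<sigma> n m = 1" "chiY \<sigma> n m = 0" | "chiX \<sigma> n m = 0" "chiY \<sigma> n m = 1"
proof -
  have "(-1 :: complex) powi (n + m) \<in> {1, -1}"
    by (cases "even (n + m)") simp_all
  with assms that show thesis
    unfolding chiX_def chiY_def by auto
qed

lemma chi_at_origin [simp]:
  "chiX 1 0 0 = 1" "chiY 1 0 0 = 0" "chiX (-1) 0 0 = 0" "chiY (-1) 0 0 = 1"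
  by (simp_all add: chiX_def chiY_def)

lemma quad_poly_interchange:
  "quad_poly fam \<epsilon> \<delta> (interchange w) n m \<alpha> \<beta> \<sigma> = quad_poly fam \<epsilon> \<delta> w n m \<alpha> \<beta> \<sigma>"
  by (cases w; cases fam) (simp_all add: algebra_simps)

text \<open>Parity \<open>Y = 1\<close> (\<open>n = m = 0\<close>, \<open>\<sigma> = -1\<close>) makes the white variables the original ones;
  parity \<open>X = 1\<close> (\<open>\<sigma> = 1\<close>) does so for the black variables.\<close>

lemma quad_poly_white_vars:
  assumes "\<sigma> \<in> {1, -1}"
  shows "quad_poly fam \<epsilon> \<delta> w n m \<alpha> \<beta> \<sigma>
    = quad_poly fam \<epsilon> \<delta> (white_vars \<sigma> n m w) 0 0 \<alpha> \<beta> (-1)"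
  by (rule chi_cases[OF assms, of n m]; cases w; cases fam) (simp_all add: algebra_simps)

lemma quad_poly_black_vars:
  assumes "\<sigma> \<in> {1, -1}"
  shows "quad_poly fam \<epsilon> \<delta> w n m \<alpha> \<beta> \<sigma>
    = quad_poly fam \<epsilon> \<delta> (black_vars \<sigma> n m w) 0 0 \<alpha> \<beta> 1"
  by (rule chi_cases[OF assms, of n m]; cases w; cases fam) (simp_all add: algebra_simps)

text \<open>Cross-multiplication with a cofactor: \<open>E\<close> will be the quadrilateral
  polynomial, \<open>B / D\<close> the divisor leg or what remains of it after cancellation, so
  \<open>B\<close> is nonzero by genericity. Each application needs only a cofactor \<open>k\<close>
  and one polynomial identity.\<close>

lemma quotient_of_quotients_eq_iff:
  fixes A :: "'a :: field"
  assumes "B \<noteq> 0" "C \<noteq> 0" "D \<noteq> 0" "Q \<noteq> 0" "k \<noteq> 0"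
    and "A * D * Q - P * B * C = k * E"
  shows "(A / C) / (B / D) = P / Q \<longleftrightarrow> E = 0"
proof -
  have "(A / C) / (B / D) = P / Q \<longleftrightarrow> A * D * Q - P * B * C = 0"
    using assms(1-4) by (auto simp: field_simps)
  then show ?thesis
    using assms(5,6) by simp
qed

lemma quotient_eq_iff:
  fixes A :: "'a :: field"
  assumes "B \<noteq> 0" "Q \<noteq> 0" "k \<noteq> 0" and "A * Q - P * B = k * E"
  shows "A / B = P / Q \<longleftrightarrow> E = 0"
  using quotient_of_quotients_eq_iff[of B 1 1 Q k A P E] assms by simp

lemma white_relation_iff:
  assumes "white_generic fam \<epsilon> \<delta> \<alpha> \<beta> x" and "fam = H3 \<Longrightarrow> \<alpha> * \<beta> \<noteq> 0"
  shows "three_leg_relation (white_form fam \<epsilon> \<delta>) \<alpha> \<beta> x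
    \<longleftrightarrow> quad_poly fam \<epsilon> \<delta> x 0 0 \<alpha> \<beta> (-1) = 0"
proof -
  obtain x1 x2 x3 x4 where x: "x = (x1, x2, x3, x4)" by (cases x)
  show ?thesis
  proof (cases fam)
    case H1
    with assms x show ?thesis by (auto simp: field_simps)
  next
    case H2
    show ?thesis
      using assms(1) unfolding x H2 white_form.simps three_leg_relation.simps
      by (intro quotient_eq_iff[where k = 1])
        (simp_all add: algebra_simps power2_eq_square power3_eq_cube)
  next
    case H3
    have "\<alpha> \<noteq> 0" "\<beta> \<noteq> 0" "x1 \<noteq> 0" "\<beta> * x4 - \<alpha> * x1 \<noteq> 0"
      and "\<beta> * x1 * x3 + \<delta> * \<beta>\<^sup>2 - \<epsilon> * x1\<^sup>2 \<noteq> 0"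
      using assms x H3 by auto
    \<comment> \<open>Once the long leg is a single quotient, the cross-multiplied difference
      vanishes identically at \<open>x1 = 0\<close>; hence the factor \<open>x1\<close> in
      \<open>k\<close>. The factors \<alpha> and \<beta> in \<open>k\<close> clear the denominator
      of the polynomial.\<close>
    then show ?thesis
      unfolding x H3 white_form.simps three_leg_relation.simps times_divide_times_eq
      by (intro quotient_eq_iff[where k = "- \<alpha> * \<beta> * x1"])
        (simp_all add: field_simps power2_eq_square)
  qed
qed

text \<open>Let \<open>s\<close> be the chosen root. Replacing \<open>s\<close> by
  \<open>- s\<close> swaps numerator and denominator in every leg, so the cross-multiplied
  difference is odd in \<open>s\<close>: it is \<open>s\<close> times a polynomial in the radicand.
  Hence the branch does not matter, and \<open>s\<close> divides each cofactor \<open>k\<close>,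
  which is nonzero because the radicand is.\<close>

lemma black_relation_iff:
  assumes "black_generic sq fam \<epsilon> \<delta> \<alpha> \<beta> y" and "fam = H3 \<Longrightarrow> \<alpha> * \<beta> \<noteq> 0"
    and sq: "\<And>z. (sq z)\<^sup>2 = z"
  shows "three_leg_relation (black_form sq fam \<epsilon> \<delta>) \<alpha> \<beta> y
    \<longleftrightarrow> quad_poly fam \<epsilon> \<delta> y 0 0 \<alpha> \<beta> 1 = 0"
proof -
  obtain y1 y2 y3 y4 where y: "y = (y1, y2, y3, y4)" by (cases y)
  have sq_nonzero: "sq z \<noteq> 0" if "z \<noteq> 0" for z
    using that sq[of z] by auto
  show ?thesis
  proof (cases fam)
    case H1
    define s where "s = sq \<epsilon>"
    have \<epsilon>: "\<epsilon> = s\<^sup>2" using sq s_def by simp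
    have nz: "s \<noteq> 0" "1 + s * y1 \<noteq> 0" "1 - s * y1 \<noteq> 0" "1 + s * y2 \<noteq> 0"
        "1 + s * y3 \<noteq> 0" "1 - s * y3 \<noteq> 0" "y4 - y1 - s * (\<alpha> - \<beta>) \<noteq> 0"
      using assms(1) y H1 sq_nonzero by (auto simp: s_def)
    \<comment> \<open>The factor in \<open>y1\<close> is common to both legs and cancels; its
      numerator is nonzero because it divides the divisor leg.\<close>
    have "((1 - s * y1) / (1 + s * y1) * ((1 - s * y2) / (1 + s * y2)))
        / ((1 - s * y1) / (1 + s * y1) * ((1 - s * y3) / (1 + s * y3)))
      = ((1 - s * y2) / (1 + s * y2)) / ((1 - s * y3) / (1 + s * y3))"
      using nz by simp
    also have "\<dots> = (y4 - y1 + s * (\<alpha> - \<beta>)) / (y4 - y1 - s * (\<alpha> - \<beta>))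
      \<longleftrightarrow> quad_poly H1 \<epsilon> \<delta> (y1, y2, y3, y4) 0 0 \<alpha> \<beta> 1 = 0"
      using nz by (intro quotient_of_quotients_eq_iff[where k = "2 * s"])
        (simp_all add: \<epsilon> algebra_simps power2_eq_square)
    finally show ?thesis
      by (simp add: y H1 s_def)
  next
    case H2
    define s where "s = sq (1 + 8 * \<epsilon> * y1)"
    have s2: "s * s = 1 + 8 * \<epsilon> * y1"
      using sq by (simp add: s_def flip: power2_eq_square)
    have nz: "s \<noteq> 0" "\<epsilon> \<noteq> 0" "1 - 4 * \<epsilon> * (y2 + \<alpha>) + s \<noteq> 0"
        "1 - 4 * \<epsilon> * (y3 + \<beta>) + s \<noteq> 0" "1 - 4 * \<epsilon> * (y3 + \<beta>) - s \<noteq> 0"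
        "y1 - y4 + (\<alpha> - \<beta>) * (2 * \<epsilon> * (\<alpha> - \<beta>) - s) \<noteq> 0"
      using assms(1) y H2 sq_nonzero by (auto simp: s_def)
    show ?thesis
      unfolding y H2 black_form.simps three_leg_relation.simps s_def[symmetric]
    proof (rule quotient_of_quotients_eq_iff[where k = "- 8 * \<epsilon> * s"])
      show "(1 - 4 * \<epsilon> * (y2 + \<alpha>) - s) * (1 - 4 * \<epsilon> * (y3 + \<beta>) + s)
            * (y1 - y4 + (\<alpha> - \<beta>) * (2 * \<epsilon> * (\<alpha> - \<beta>) - s))
          - (y1 - y4 + (\<alpha> - \<beta>) * (2 * \<epsilon> * (\<alpha> - \<beta>) + s))
            * (1 - 4 * \<epsilon> * (y3 + \<beta>) - s) * (1 - 4 * \<epsilon> * (y2 + \<alpha>) + s)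
          = - 8 * \<epsilon> * s * quad_poly H2 \<epsilon> \<delta> (y1, y2, y3, y4) 0 0 \<alpha> \<beta> 1"
        unfolding quad_poly.simps chi_at_origin using s2 by algebra
    qed (use nz in simp_all)
  next
    case H3
    define s where "s = sq (y1\<^sup>2 + 4 * \<epsilon> * \<delta>)"
    have s2: "s * s = y1\<^sup>2 + 4 * \<epsilon> * \<delta>"
      using sq by (simp add: s_def flip: power2_eq_square)
    have nz: "s \<noteq> 0" "\<epsilon> \<noteq> 0" "\<alpha> \<noteq> 0" "\<beta> \<noteq> 0" "\<alpha> * (y1 - s) - 2 * \<epsilon> * y2 \<noteq> 0"
        "\<beta> * (y1 - s) - 2 * \<epsilon> * y3 \<noteq> 0" "\<beta> * (y1 + s) - 2 * \<epsilon> * y3 \<noteq> 0"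
        "(\<alpha>\<^sup>2 + \<beta>\<^sup>2) * y1 - 2 * \<alpha> * \<beta> * y4 - (\<alpha>\<^sup>2 - \<beta>\<^sup>2) * s \<noteq> 0"
      using assms(1,2) y H3 sq_nonzero by (auto simp: s_def)
    \<comment> \<open>Naming the only fractional coefficient turns the identity below into a
      division-free one modulo the relations \<open>s2\<close> and \<open>r\<close>, as
      \<open>algebra\<close> requires.\<close>
    define r where "r = \<epsilon> * (\<alpha>\<^sup>2 - \<beta>\<^sup>2) / (\<alpha> * \<beta>)"
    have r: "r * (\<alpha> * \<beta>) = \<epsilon> * (\<alpha>\<^sup>2 - \<beta>\<^sup>2)" using nz by (simp add: r_def)
    show ?thesis
      unfolding y H3 black_form.simps three_leg_relation.simps s_def[symmetric]
    proof (rule quotient_of_quotients_eq_iff[where k = "8 * \<alpha> * \<beta> * \<epsilon> * s"])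
      show "(\<alpha> * (y1 + s) - 2 * \<epsilon> * y2) * (\<beta> * (y1 - s) - 2 * \<epsilon> * y3)
            * ((\<alpha>\<^sup>2 + \<beta>\<^sup>2) * y1 - 2 * \<alpha> * \<beta> * y4 - (\<alpha>\<^sup>2 - \<beta>\<^sup>2) * s)
          - ((\<alpha>\<^sup>2 + \<beta>\<^sup>2) * y1 - 2 * \<alpha> * \<beta> * y4 + (\<alpha>\<^sup>2 - \<beta>\<^sup>2) * s)
            * (\<beta> * (y1 + s) - 2 * \<epsilon> * y3) * (\<alpha> * (y1 - s) - 2 * \<epsilon> * y2)
          = 8 * \<alpha> * \<beta> * \<epsilon> * s * quad_poly H3 \<epsilon> \<delta> (y1, y2, y3, y4) 0 0 \<alpha> \<beta> 1"
        unfolding quad_poly.simps chi_at_origin r_def[symmetric] using s2 r by algebra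
    qed (use nz in simp_all)
  qed
qed

text \<open>This makes precise that the two forms are different. H1 differs by constructor; for H2
  and H3 the forms are compared as total functions, with \<open>x / 0 = 0\<close>, so one point of
  disagreement suffices.\<close>

lemma white_form_neq_black_form:
  assumes sq: "\<And>z. (sq z)\<^sup>2 = z"
  shows "white_form fam \<epsilon> \<delta> \<noteq> black_form sq fam \<epsilon> \<delta>"
proof
  assume eq: "white_form fam \<epsilon> \<delta> = black_form sq fam \<epsilon> \<delta>"
  have sq0: "sq 0 = 0" using sq[of 0] by simp
  show False
  proof (cases fam)
    case H1
    with eq show False by simp
  next
    case H2
    (* At a zero of 1 + 8 * \<epsilon> * x1 the black leg only takes the values 0 and 1; for \<epsilon> = 0 it is
       constant. The white leg is affine in its second argument with slope 1. *)
    have leg: "x1 + x2 + \<alpha> - 2 * \<epsilon> * (x1 + \<alpha>)\<^sup>2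
        = (1 - 4 * \<epsilon> * (x2 + \<alpha>) - sq (1 + 8 * \<epsilon> * x1))
          / (1 - 4 * \<epsilon> * (x2 + \<alpha>) + sq (1 + 8 * \<epsilon> * x1))" for x1 x2 \<alpha>
      using eq H2 by (simp add: fun_eq_iff)
    show False
    proof (cases "\<epsilon> = 0")
      case True
      with leg[of 0 0 0] leg[of 0 1 0] show False by simp
    next
      case False
      define x1 where "x1 = - 1 / (8 * \<epsilon>)"
      have "1 + 8 * \<epsilon> * x1 = 0" using False by (simp add: x1_def)
      \<comment> \<open>The second argument is chosen to give the white leg the value 2.\<close>
      with leg[of x1 "2 - x1 + 2 * \<epsilon> * x1\<^sup>2" 0] show False
        by (simp add: sq0 divide_self_if split: if_splits)
    qed
  next
    case H3
    have long_leg: "(\<alpha> / \<beta>) * ((\<alpha> * x4 - \<beta> * x1) / (\<beta> * x4 - \<alpha> * x1))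
        = ((\<alpha>\<^sup>2 + \<beta>\<^sup>2) * x1 - 2 * \<alpha> * \<beta> * x4 + (\<alpha>\<^sup>2 - \<beta>\<^sup>2) * sq (x1\<^sup>2 + 4 * \<epsilon> * \<delta>))
          / ((\<alpha>\<^sup>2 + \<beta>\<^sup>2) * x1 - 2 * \<alpha> * \<beta> * x4 - (\<alpha>\<^sup>2 - \<beta>\<^sup>2) * sq (x1\<^sup>2 + 4 * \<epsilon> * \<delta>))"
      for \<alpha> \<beta> x1 x4
      using eq H3 by (simp add: fun_eq_iff del: times_divide_eq_left times_divide_eq_right)
    define s where "s = sq (4 * \<epsilon> * \<delta>)"
    \<comment> \<open>At \<alpha> = 2, \<beta> = 1, \<open>x1 = 0\<close> the white long leg is 4
      for every nonzero \<open>x4\<close>. The black one has numerator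
      \<open>3 * s - 4 * x4\<close>, which this \<open>x4\<close> makes zero if \<open>s\<close> is
      nonzero; if \<open>s = 0\<close>, the black long leg is 1.\<close>
    define x4 where "x4 = (if s = 0 then 1 else 3 * s / 4)"
    from long_leg[of 2 1 x4 0] show False
      by (auto simp: x4_def s_def[symmetric] split: if_splits)
  qed
qed

theorem mainTheorem5:
  fixes \<epsilon> \<delta> \<alpha> \<beta> \<sigma> :: complex
    and n m :: int
    and u :: "int \<Rightarrow> int \<Rightarrow> complex"
    and sq :: "complex \<Rightarrow> complex"
    and fam :: family
  assumes "\<sigma> \<in> {1, -1}"
    and "\<And>z. (sq z)\<^sup>2 = z"
    and "fam = H3 \<Longrightarrow> \<alpha> * \<beta> \<noteq> 0"
  shows "white_form fam \<epsilon> \<delta> \<noteq> black_form sq fam \<epsilon> \<delta> \<and>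
    (\<forall>w \<in> {quad_values u n m, interchange (quad_values u n m)}.
      (white_generic fam \<epsilon> \<delta> \<alpha> \<beta> (white_vars \<sigma> n m w) \<longrightarrow>
        (quad_poly fam \<epsilon> \<delta> (quad_values u n m) n m \<alpha> \<beta> \<sigma> = 0 \<longleftrightarrow>
         three_leg_relation (white_form fam \<epsilon> \<delta>) \<alpha> \<beta> (white_vars \<sigma> n m w))) \<and>
      (black_generic sq fam \<epsilon> \<delta> \<alpha> \<beta> (black_vars \<sigma> n m w) \<longrightarrow>
        (quad_poly fam \<epsilon> \<delta> (quad_values u n m) n m \<alpha> \<beta> \<sigma> = 0 \<longleftrightarrow>
         three_leg_relation (black_form sq fam \<epsilon> \<delta>) \<alpha> \<beta> (black_vars \<sigma> n m w))))"
proof (intro conjI ballI)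
  show "white_form fam \<epsilon> \<delta> \<noteq> black_form sq fam \<epsilon> \<delta>"
    using assms(2) by (rule white_form_neq_black_form)
next
  fix w
  assume "w \<in> {quad_values u n m, interchange (quad_values u n m)}"
  then have w: "quad_poly fam \<epsilon> \<delta> (quad_values u n m) n m \<alpha> \<beta> \<sigma>
      = quad_poly fam \<epsilon> \<delta> w n m \<alpha> \<beta> \<sigma>"
    by (auto simp: quad_poly_interchange)
  show "white_generic fam \<epsilon> \<delta> \<alpha> \<beta> (white_vars \<sigma> n m w) \<longrightarrow>
      (quad_poly fam \<epsilon> \<delta> (quad_values u n m) n m \<alpha> \<beta> \<sigma> = 0 \<longleftrightarrow>
       three_leg_relation (white_form fam \<epsilon> \<delta>) \<alpha> \<beta> (white_vars \<sigma> n m w))"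
    using white_relation_iff assms(3)
    unfolding w quad_poly_white_vars[OF assms(1), of _ _ _ w] by blast
  show "black_generic sq fam \<epsilon> \<delta> \<alpha> \<beta> (black_vars \<sigma> n m w) \<longrightarrow>
      (quad_poly fam \<epsilon> \<delta> (quad_values u n m) n m \<alpha> \<beta> \<sigma> = 0 \<longleftrightarrow>
       three_leg_relation (black_form sq fam \<epsilon> \<delta>) \<alpha> \<beta> (black_vars \<sigma> n m w))"
    using black_relation_iff assms(2,3)
    unfolding w quad_poly_black_vars[OF assms(1), of _ _ _ w] by blast
qed

end
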